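(* Let $\lambda\ge 0$. Suppose $x_0$ is a $T$-periodic solution of $$\ddot x(t)=g\Big(x(t),\dot x(t),\int_{-\infty}^t\gamma_a^b(t-s)\,\varphi(x(s),\dot x(s))\,ds\Big)+\lambda f\big(t,x(t),\dot x(t)\big),$$ and, for $t\in\mathbb{R}$, let $$y_0(t):=\dot x_0(t),\qquad y_i(t):=\int_{-\infty}^t\gamma_a^i(t-s)\,\varphi(x_0(s),y_0(s))\,ds,\quad i=1,\ldots,b.$$ Then $(x_0,y_0,y_1,\ldots,y_b)$ is a $T$-periodic solution of the system $$\dot\xi=G(\xi)+\lambda F(t,\xi),\qquad \xi\in\mathbb{R}^{b+2}.$$
   Context: Let $a>0$, $b\in\mathbb{N}\setminus\{0\}$, $T>0$. Let $g\colon\mathbb{R}^3\to\mathbb{R}$ be continuous, $\varphi\colon\mathbb{R}^2\to\mathbb{R}$ locally Lipschitz, and $f\colon\mathbb{R}^3\to\mathbb{R}$ continuous and $T$-periodic in its first variable. For $i\in\mathbb{N}\setminus\{0\}$, the gamma probability density $\gamma_a^i$ is $$\gamma_a^i(s)=\frac{a^i s^{i-1}e^{-as}}{(i-1)!}\ \text{ for } s\ge 0,\qquad \gamma_a^i(s)=0\ \text{ for } s<0.$$ The maps $G\colon\mathbb{R}^{b+2}\to\mathbb{R}^{b+2}$ and $F\colon\mathbb{R}\times\mathbb{R}^{b+2}\to\mathbb{R}^{b+2}$ are $$G(u,v_0,v_1,\ldots,v_b)=\big(v_0,\;g(u,v_0,v_b),\;a(\varphi(u,v_0)-v_1),\;a(v_1-v_2),\ldots,a(v_{b-1}-v_b)\big),$$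 $$F(t,u,v_0,v_1,\ldots,v_b)=\big(0,f(t,u,v_0),0,\ldots,0\big)\quad(\text{with } b \text{ trailing zeros}).$$ A $T$-periodic solution of the second order equation is a $C^2$ function $x\colon\mathbb{R}\to\mathbb{R}$ of period $T$ satisfying the equation identically on $\mathbb{R}$; a $T$-periodic solution of the system is a $C^1$ function $\xi\colon\mathbb{R}\to\mathbb{R}^{b+2}$ of period $T$ satisfying the system identically on $\mathbb{R}$. *)

theory Defs
  imports "HOL-Analysis.Analysis" "HOL-Probability.Distributions"
begin

(* R^n is real ^ 'n with a finite linearly ordered index type 'n; the order numbers
   the coordinates 0, 1, ..., CARD('n) - 1. *)

definition pos :: "'n::{finite,linorder} \<Rightarrow> nat" where
  "pos k = card {..<k}"

definition tuple :: "(nat \<Rightarrow> real) \<Rightarrow> real ^ 'n::{finite,linorder}" where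
  "tuple h = (\<chi> k. h (pos k))"

definition coord :: "real ^ 'n::{finite,linorder} \<Rightarrow> nat \<Rightarrow> real" where
  "coord w j = w $ inv pos j"

lemma pos_strict_mono: "k < l \<Longrightarrow> pos k < pos l"
  unfolding pos_def by (rule psubset_card_mono) auto

lemma inj_pos: "inj pos"
  by (metis injI less_irrefl neqE pos_strict_mono)

lemma bij_betw_pos: "bij_betw (pos :: 'n::{finite,linorder} \<Rightarrow> nat) UNIV {..<CARD('n)}"
proof -
  have "range (pos :: 'n \<Rightarrow> nat) \<subseteq> {..<CARD('n)}"
    by (auto simp: pos_def intro!: psubset_card_mono)
  moreover have "card (range (pos :: 'n \<Rightarrow> nat)) = CARD('n)"
    by (rule card_image) (rule inj_pos)
  ultimately have "range (pos :: 'n \<Rightarrow> nat) = {..<CARD('n)}"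
    by (intro card_subset_eq) auto
  then show ?thesis
    using inj_pos by (auto simp: bij_betw_def)
qed

lemma coord_tuple:
  assumes "j < CARD('n)"
  shows "coord (tuple h :: real ^ 'n::{finite,linorder}) j = h j"
proof -
  have "j \<in> range (pos :: 'n \<Rightarrow> nat)"
    using assms bij_betw_pos by (auto simp: bij_betw_def)
  then show ?thesis
    by (simp add: coord_def tuple_def f_inv_into_f)
qed

lemma tuple_coord: "tuple (coord w) = w"
  by (simp add: tuple_def coord_def inj_pos vec_eq_iff)

definition gamma_density :: "real \<Rightarrow> nat \<Rightarrow> real \<Rightarrow> real" where
  "gamma_density a i s =
     (if s \<ge> 0 then a ^ i * s ^ (i - 1) * exp (- (a * s)) / fact (i - 1) else 0)"

lemma gamma_density_eq_erlang:
  "i \<ge> 1 \<Longrightarrow> gamma_density a i = erlang_density (i - 1) a"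
  by (auto simp: gamma_density_def erlang_density_def fun_eq_iff)

definition locally_lipschitz :: "('a::metric_space \<Rightarrow> 'b::metric_space) \<Rightarrow> bool" where
  "locally_lipschitz h \<longleftrightarrow> (\<forall>p. \<exists>r>0. \<exists>L. L-lipschitz_on (cball p r) h)"

(* The vector (u, v_0, ..., v_b) has coord 0 = u and coord (i + 1) = v_i. *)

definition G_map ::
  "real \<Rightarrow> nat \<Rightarrow> (real \<times> real \<times> real \<Rightarrow> real) \<Rightarrow> (real \<times> real \<Rightarrow> real)
     \<Rightarrow> real ^ 'n::{finite,linorder} \<Rightarrow> real ^ 'n::{finite,linorder}" where
  "G_map a b g \<phi> w =
     (let u = coord w 0; v = (\<lambda>i. coord w (i + 1)) in
      tuple (\<lambda>j. if j = 0 then v 0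
                 else if j = 1 then g (u, v 0, v b)
                 else if j = 2 then a * (\<phi> (u, v 0) - v 1)
                 else a * (v (j - 2) - v (j - 1))))"

definition F_map ::
  "(real \<times> real \<times> real \<Rightarrow> real) \<Rightarrow> real
     \<Rightarrow> real ^ 'n::{finite,linorder} \<Rightarrow> real ^ 'n::{finite,linorder}" where
  "F_map f t w = tuple (\<lambda>j. if j = 1 then f (t, coord w 0, coord w 1) else 0)"

(* The first two conjuncts say that x is of class C^2. *)
definition periodic_solution_delay ::
  "real \<Rightarrow> real \<Rightarrow> nat \<Rightarrow> (real \<times> real \<times> real \<Rightarrow> real) \<Rightarrow> (real \<times> real \<Rightarrow> real)
     \<Rightarrow> (real \<times> real \<times> real \<Rightarrow> real) \<Rightarrow> real \<Rightarrow> (real \<Rightarrow> real) \<Rightarrow> bool" where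
  "periodic_solution_delay T a b g \<phi> f lam x \<longleftrightarrow>
     x C1_differentiable_on UNIV \<and> deriv x C1_differentiable_on UNIV \<and>
     (\<forall>t. x (t + T) = x t) \<and>
     (\<forall>t. deriv (deriv x) t =
            g (x t, deriv x t,
               (LBINT s=-\<infinity>..ereal t. gamma_density a b (t - s) * \<phi> (x s, deriv x s)))
            + lam * f (t, x t, deriv x t))"

definition periodic_solution_system ::
  "real \<Rightarrow> (real \<Rightarrow> 'a::real_normed_vector \<Rightarrow> 'a) \<Rightarrow> (real \<Rightarrow> 'a) \<Rightarrow> bool" where
  "periodic_solution_system T H \<xi> \<longleftrightarrow>
     \<xi> C1_differentiable_on UNIV \<and>
     (\<forall>t. \<xi> (t + T) = \<xi> t) \<and>
     (\<forall>t. (\<xi> has_vector_derivative H t (\<xi> t)) (at t))"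

end

theory Submission
  imports Defs
begin

text \<open>
  The history term \<open>p(s) = \<phi>(x\<^sub>0(s), x\<^sub>0'(s))\<close> is continuous and periodic, hence bounded.
  Up to the factor \<open>a\<^sup>i e\<^sup>-\<^sup>a\<^sup>t / (i - 1)!\<close>, the convolution \<open>y\<^sub>i(t)\<close> is the integral of
  \<open>(t - s)\<^sup>i\<^sup>-\<^sup>1 e\<^sup>a\<^sup>s p(s)\<close> over \<open>s < t\<close>. Differentiating it in \<open>t\<close> lowers the exponent of
  \<open>t - s\<close> by one, or gives the integrand at \<open>t\<close> if that exponent is zero, while the
  exponential factor contributes \<open>- a y\<^sub>i\<close>. This is the linear chain
  \<open>y\<^sub>i' = a (y\<^sub>i\<^sub>-\<^sub>1 - y\<^sub>i)\<close> with \<open>p\<close> in place of \<open>y\<^sub>0\<close> when \<open>i = 1\<close>.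
\<close>

section \<open>Boundedness of periodic functions and integrability on half-lines\<close>

text \<open>Translation by whole periods moves every point into [0, T], so all values are attained
  on a compact interval.\<close>

lemma bounded_periodic_continuous:
  fixes p :: "real \<Rightarrow> 'a::metric_space"
  assumes "T > 0" and cont: "continuous_on UNIV p" and per: "\<And>t. p (t + T) = p t"
  shows "bounded (range p)"
proof -
  have shift: "p (t + of_int k * T) = p t" for t and k :: int
  proof (induction k rule: int_induct[where k = 0])
    case (step1 i)
    then show ?case using per[of "t + of_int i * T"] by (simp add: algebra_simps)
  next
    case (step2 i)
    then show ?case using per[of "t + of_int (i - 1) * T"] by (simp add: algebra_simps)
  qed simp
  have "p t \<in> p ` {0..T}" for t
  proof (rule image_eqI)
    define k where "k = \<lfloor>t / T\<rfloor>"
    have "of_int k \<le> t / T" "t / T \<le> of_int k + 1"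
      by (auto simp: k_def)
    then show "t + of_int (- k) * T \<in> {0..T}"
      using \<open>T > 0\<close> by (simp add: field_simps)
    show "p t = p (t + of_int (- k) * T)"
      by (rule shift[symmetric])
  qed
  moreover have "compact (p ` {0..T})"
    by (intro compact_continuous_image continuous_on_subset[OF cont]) auto
  ultimately show ?thesis
    by (meson bounded_subset compact_imp_bounded image_subsetI)
qed

lemma integrable_erlang_density:
  assumes "0 < l"
  shows "integrable lborel (erlang_density k l)"
  using nn_integral_erlang_ith_moment[OF assms, of k 0] assms
  by (intro integrableI_nonneg) auto

text \<open>On the nonpositive half-line a multiple of the reflected Erlang density dominates the
  integrand; on a bounded interval continuity suffices.\<close>

lemma set_integrable_power_exp_bounded:
  fixes h :: "real \<Rightarrow> real"
  assumes "a > 0" and cont: "continuous_on UNIV h" and bdd: "bounded (range h)"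
  shows "set_integrable lborel {..t} (\<lambda>s. s ^ k * (exp (a * s) * h s))"
    (is "set_integrable _ _ ?q")
proof -
  obtain B where B: "\<And>s. \<bar>h s\<bar> \<le> B"
    using bdd by (auto simp: bounded_iff)
  have meas: "set_borel_measurable lborel {..0} ?q"
    unfolding set_borel_measurable_def
    using borel_measurable_continuous_onI[OF cont] by measurable
  have "integrable lborel (\<lambda>s. erlang_density k a (0 + (- 1) * s))"
    by (intro lborel_integrable_real_affine integrable_erlang_density \<open>a > 0\<close>) simp
  \<comment> \<open>The factor \<open>fact k / a ^ Suc k\<close> cancels the normalization of the
    density, leaving \<open>B\<close> times the weight.\<close>
  then have "integrable lborel (\<lambda>s. indicator {..0} s *\<^sub>R (B * (fact k / a ^ Suc k * erlang_density k a (- s))))"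
    by (intro integrable_mult_indicator integrable_mult_right) auto
  then have "set_integrable lborel {..0} (\<lambda>s. B * (fact k / a ^ Suc k * erlang_density k a (- s)))"
    by (simp add: set_integrable_def)
  then have "set_integrable lborel {..0} ?q"
  proof (rule set_integrable_bound[OF _ meas], intro always_eventually allI impI)
    fix s :: real assume "s \<in> {..0}"
    then have "B * (fact k / a ^ Suc k * erlang_density k a (- s)) = B * (\<bar>s\<bar> ^ k * exp (a * s))"
      using \<open>a > 0\<close> by (simp add: erlang_density_def)
    also have "\<dots> \<ge> \<bar>h s\<bar> * (\<bar>s\<bar> ^ k * exp (a * s))"
      by (intro mult_right_mono B) auto
    also have "\<bar>h s\<bar> * (\<bar>s\<bar> ^ k * exp (a * s)) = norm (?q s)"
      by (simp add: abs_mult power_abs mult_ac)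
    finally show "norm (?q s) \<le> norm (B * (fact k / a ^ Suc k * erlang_density k a (- s)))"
      unfolding real_norm_def by (rule order.trans[OF _ abs_ge_self])
  qed
  \<comment> \<open>The absolute value makes the union contain \<open>{..t}\<close> for either sign
    of \<open>t\<close>.\<close>
  moreover have "set_integrable lborel {0..\<bar>t\<bar>} ?q"
    by (intro borel_integrable_atLeastAtMost' continuous_intros continuous_on_subset[OF cont]) auto
  ultimately have "set_integrable lborel ({..0} \<union> {0..\<bar>t\<bar>}) ?q"
    by (rule set_integrable_Un) auto
  then show ?thesis
    by (rule set_integrable_subset) auto
qed

section \<open>Differentiation of integrals from minus infinity\<close>

text \<open>Cutting at a fixed point below \<open>t\<close> leaves a constant plus an integral over
  a bounded interval, to which the fundamental theorem applies.\<close>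

lemma has_derivative_integral_from_minus_infinity:
  fixes h :: "real \<Rightarrow> real"
  assumes cont: "continuous_on UNIV h" and int: "\<And>t. set_integrable lborel {..t} h"
  shows "((\<lambda>t. LBINT s=-\<infinity>..ereal t. h s) has_real_derivative h t) (at t)"
proof -
  let ?c = "t - 1"
  have split: "(LBINT s=-\<infinity>..ereal u. h s) = (LBINT s=-\<infinity>..ereal ?c. h s) + (LBINT s=?c..u. h s)" for u
  proof (rule interval_integral_sum[symmetric])
    \<comment> \<open>The maximum covers both orders of \<open>?c\<close> and
      \<open>u\<close>.\<close>
    have "set_integrable lborel {..<max ?c u} h"
      by (rule set_integrable_subset[OF int[of "max ?c u"]]) auto
    then show "interval_lebesgue_integrable lborel (min (-\<infinity>) (min (ereal ?c) (ereal u)))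
        (max (-\<infinity>) (max (ereal ?c) (ereal u))) h"
      by (simp add: interval_lebesgue_integrable_def max_def min_def split: if_splits)
  qed
  have "((\<lambda>u. LBINT s=?c..u. h s) has_vector_derivative h t) (at t within {?c..t+1})"
    by (intro interval_integral_FTC2 continuous_on_subset[OF cont]) auto
  moreover have "at t within {?c..t+1} = at t"
    by (rule at_within_interior) auto
  ultimately have "((\<lambda>u. LBINT s=?c..u. h s) has_real_derivative h t) (at t)"
    by (simp add: has_real_derivative_iff_has_vector_derivative)
  then have "((\<lambda>u. (LBINT s=-\<infinity>..ereal ?c. h s) + (LBINT s=?c..u. h s)) has_real_derivative h t) (at t)"
    by (auto intro!: derivative_eq_intros)
  then show ?thesis
    by (subst ext[of "\<lambda>u. LBINT s=-\<infinity>..ereal u. h s", OF split])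
qed

text \<open>
  The binomial theorem separates \<open>t\<close> from \<open>s\<close>, so that only the fundamental theorem of calculus
  is needed and no differentiation under the integral sign.
\<close>

lemma has_derivative_integral_power_kernel:
  fixes h :: "real \<Rightarrow> real"
  assumes cont: "continuous_on UNIV h"
    and int: "\<And>k t. set_integrable lborel {..t} (\<lambda>s. s ^ k * h s)"
  shows "((\<lambda>t. LBINT s=-\<infinity>..ereal t. (t - s) ^ n * h s) has_real_derivative
           (if n = 0 then h t else of_nat n * (LBINT s=-\<infinity>..ereal t. (t - s) ^ (n - 1) * h s))) (at t)"
proof -
  \<comment> \<open>The integrands of these moments do not involve \<open>t\<close>, so each moment
    is differentiable by the previous lemma.\<close>
  define M where "M k t = (LBINT s=-\<infinity>..ereal t. s ^ k * h s)" for k and t :: real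
  have dM: "(M k has_real_derivative t ^ k * h t) (at t)" for k t
    unfolding M_def
    by (intro has_derivative_integral_from_minus_infinity int continuous_intros cont)
  have int': "set_integrable lborel {..<t} (\<lambda>s. s ^ k * h s)" for k t
    by (rule set_integrable_subset[OF int[of t]]) auto
  have expand: "(LBINT s=-\<infinity>..ereal t. (t - s) ^ n * h s)
      = (\<Sum>k\<le>n. of_nat (n choose k) * (- 1) ^ k * t ^ (n - k) * M k t)" for n t
  proof -
    have "(t - s) ^ n = (\<Sum>k\<le>n. of_nat (n choose k) * (- 1) ^ k * t ^ (n - k) * s ^ k)" for s
      using binomial_ring[of "- s" t n] by (simp add: power_minus[of s] mult_ac)
    then have "(LBINT s=-\<infinity>..ereal t. (t - s) ^ n * h s)
      = (LBINT s=-\<infinity>..ereal t. (\<Sum>k\<le>n. of_nat (n choose k) * (- 1) ^ k * t ^ (n - k) * (s ^ k * h s)))"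
      by (simp add: sum_distrib_right mult.assoc)
    also have "\<dots> = (\<Sum>k\<le>n. of_nat (n choose k) * (- 1) ^ k * t ^ (n - k) * M k t)"
      using int'
      by (simp add: M_def interval_lebesgue_integral_le_eq set_lebesgue_integral_def set_integrable_def
          sum_distrib_left mult.left_commute[of "indicator _ _"])
    finally show ?thesis .
  qed
  show ?thesis
  proof (cases n)
    case 0
    then show ?thesis using dM[of 0] by (simp add: M_def[abs_def])
  next
    case (Suc m)
    let ?c = "\<lambda>n k. of_nat (n choose k) * (- 1) ^ k :: real"
    have "((\<lambda>t. \<Sum>k\<le>n. ?c n k * t ^ (n - k) * M k t) has_real_derivative
       (\<Sum>k\<le>n. ?c n k * (of_nat (n - k) * t ^ (n - k - 1)) * M k t + ?c n k * t ^ (n - k) * (t ^ k * h t))) (at t)"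
      by (rule DERIV_sum, (rule derivative_eq_intros dM refl)+) (simp add: algebra_simps)
    also have "(\<Sum>k\<le>n. ?c n k * (of_nat (n - k) * t ^ (n - k - 1)) * M k t + ?c n k * t ^ (n - k) * (t ^ k * h t))
       = (\<Sum>k\<le>n. ?c n k * (of_nat (n - k) * t ^ (n - k - 1)) * M k t) + (\<Sum>k\<le>n. ?c n k * t ^ (n - k) * (t ^ k * h t))"
      by (rule sum.distrib)
    \<comment> \<open>The terms from differentiating the moments recombine by the binomial theorem
      into a power of \<open>t - t\<close>, which vanishes since \<open>n\<close> is
      positive.\<close>
    also have "(\<Sum>k\<le>n. ?c n k * t ^ (n - k) * (t ^ k * h t)) = (t - t) ^ n * h t"
      using binomial_ring[of "- t" t n] by (simp add: power_minus[of t] mult_ac sum_distrib_left)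
    also have "\<dots> = 0"
      using Suc by simp
    \<comment> \<open>The term \<open>k = n\<close> drops out through the factor
      \<open>n - k\<close>; the others match by the absorption identity for binomial
      coefficients.\<close>
    also have "(\<Sum>k\<le>n. ?c n k * (of_nat (n - k) * t ^ (n - k - 1)) * M k t)
       = (\<Sum>k\<le>m. of_nat n * (?c m k * t ^ (m - k) * M k t))"
    proof -
      have "?c n k * of_nat (n - k) = of_nat n * ?c m k" if "k \<le> m" for k
      proof -
        have "(n choose k) * (n - k) = n * (m choose k)"
          using binomial_absorb_comp[of n k] Suc by (simp add: mult.commute)
        then have "real (n choose k) * real (n - k) = real n * real (m choose k)"
          by (metis of_nat_mult)
        then show ?thesis by (simp add: mult_ac)
      qed
      then show ?thesis
        using Suc by (auto simp: mult.assoc[symmetric] intro!: sum.cong)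
    qed
    finally have "((\<lambda>t. LBINT s=-\<infinity>..ereal t. (t - s) ^ n * h s) has_real_derivative
        of_nat n * (LBINT s=-\<infinity>..ereal t. (t - s) ^ m * h s)) (at t)"
      unfolding expand by (simp only: sum_distrib_left add_0_right)
    then show ?thesis
      using Suc by (simp del: power_Suc of_nat_Suc)
  qed
qed

section \<open>Gamma convolutions: periodicity and the linear chain\<close>

text \<open>Lebesgue measure is translation invariant, the kernel sees only time differences, and
  \<open>p\<close> does not change under the shift.\<close>

lemma interval_integral_convolution_shift:
  fixes k p :: "real \<Rightarrow> real"
  assumes "\<And>s. p (s + T) = p s"
  shows "(LBINT s=-\<infinity>..ereal (t + T). k (t + T - s) * p s) = (LBINT s=-\<infinity>..ereal t. k (t - s) * p s)"
proof -
  have "(LBINT s:{..<t+T}. k (t + T - s) * p s)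
    = (LBINT s. indicator {..<t+T} (T + 1 * s) *\<^sub>R (k (t + T - (T + 1 * s)) * p (T + 1 * s)))"
    unfolding set_lebesgue_integral_def
    by (subst lborel_integral_real_affine[where c = 1 and t = T]) auto
  also have "\<dots> = (LBINT s:{..<t}. k (t - s) * p s)"
    unfolding set_lebesgue_integral_def using assms
    by (intro Bochner_Integration.integral_cong) (auto simp: indicator_def add.commute)
  finally show ?thesis
    by (simp add: interval_lebesgue_integral_le_eq)
qed

lemma gamma_density_convolution_has_derivative:
  fixes p :: "real \<Rightarrow> real"
  assumes "a > 0" and cont: "continuous_on UNIV p" and bdd: "bounded (range p)" and "i \<ge> 1"
  defines "Y \<equiv> \<lambda>i t. LBINT s=-\<infinity>..ereal t. gamma_density a i (t - s) * p s"
  shows "(Y i has_real_derivative a * ((if i = 1 then p t else Y (i - 1) t) - Y i t)) (at t)"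
proof -
  define h where "h s = exp (a * s) * p s" for s
  define Q where "Q n t = (LBINT s=-\<infinity>..ereal t. (t - s) ^ n * h s)" for n and t :: real
  \<comment> \<open>Only \<open>s < t\<close> enters the integral, so the density is given by its
    formula for nonnegative arguments, and its exponential splits into a factor in \<open>t\<close>
    and the one absorbed in \<open>h\<close>.\<close>
  have Y: "Y (Suc n) t = a ^ Suc n / fact n * exp (- (a * t)) * Q n t" for n t
  proof -
    have "Y (Suc n) t = (LBINT s=-\<infinity>..ereal t. a ^ Suc n / fact n * exp (- (a * t)) * ((t - s) ^ n * h s))"
      unfolding Y_def
      by (intro interval_integral_cong)
        (auto simp: einterval_def gamma_density_def h_def algebra_simps exp_minus exp_diff exp_add field_simps)
    then show ?thesis
      unfolding Q_def by simp
  qed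
  have dQ: "(Q n has_real_derivative (if n = 0 then h t else of_nat n * Q (n - 1) t)) (at t)" for n t
    unfolding Q_def
    by (rule has_derivative_integral_power_kernel)
      (auto simp: h_def intro!: continuous_intros cont set_integrable_power_exp_bounded assms)
  obtain n where n: "i = Suc n"
    using \<open>i \<ge> 1\<close> by (cases i) auto
  have "((\<lambda>t. a ^ Suc n / fact n * exp (- (a * t)) * Q n t) has_real_derivative
     a ^ Suc n / fact n * exp (- (a * t)) * (if n = 0 then h t else of_nat n * Q (n - 1) t)
       - a * (a ^ Suc n / fact n * exp (- (a * t)) * Q n t)) (at t)"
    by (rule derivative_eq_intros dQ refl)+ (simp add: algebra_simps)
  \<comment> \<open>For \<open>n = 0\<close> the exponentials cancel in
    \<open>exp (- (a * t)) * h t\<close>; otherwise \<open>n / fact n = 1 / fact (n - 1)\<close>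
    produces the preceding convolution.\<close>
  moreover have "a ^ Suc n / fact n * exp (- (a * t)) * (if n = 0 then h t else of_nat n * Q (n - 1) t)
       = a * (if i = 1 then p t else Y (i - 1) t)"
  proof (cases n)
    case 0
    then show ?thesis by (simp add: n h_def exp_minus)
  next
    case (Suc m)
    then show ?thesis
      by (simp add: n Y divide_simps del: of_nat_Suc)
  qed
  moreover have "Y i = (\<lambda>t. a ^ Suc n / fact n * exp (- (a * t)) * Q n t)"
    using Y n by auto
  ultimately show ?thesis
    by (simp only: right_diff_distrib)
qed

section \<open>Coordinatewise calculus and regularity\<close>

lemma tuple_nth: "tuple h $ k = h (pos k)"
  by (simp add: tuple_def)

text \<open>Differentiability is coordinatewise. Only indices below \<open>CARD('n)\<close> matter,
  as these are the values of \<open>pos\<close>.\<close>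

lemma has_vector_derivative_tuple:
  assumes "\<And>j. j < CARD('n) \<Longrightarrow> ((\<lambda>t. h t j) has_real_derivative h' j) (at t)"
  shows "((\<lambda>t. tuple (h t) :: real ^ 'n::{finite,linorder}) has_vector_derivative tuple h') (at t)"
proof -
  have "pos k < CARD('n)" for k :: 'n
    using bij_betw_pos[where 'n = 'n] by (auto simp: bij_betw_def)
  then show ?thesis
    using assms
    unfolding has_vector_derivative_def
    by (subst has_derivative_componentwise_within)
      (auto simp: Basis_vec_def inner_axis tuple_def has_field_derivative_def mult_commute_abs)
qed

lemma continuous_on_tuple:
  assumes "\<And>j. j < CARD('n) \<Longrightarrow> continuous_on S (\<lambda>t. h t j)"
  shows "continuous_on S (\<lambda>t. tuple (h t) :: real ^ 'n::{finite,linorder})"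
proof -
  have "pos k < CARD('n)" for k :: 'n
    using bij_betw_pos[where 'n = 'n] by (auto simp: bij_betw_def)
  then show ?thesis
    using assms unfolding tuple_def by (intro continuous_intros) auto
qed

lemma locally_lipschitz_imp_continuous_on:
  assumes "locally_lipschitz h"
  shows "continuous_on UNIV h"
proof -
  have "isCont h p" for p
  proof -
    obtain r L where "r > 0" and L: "L-lipschitz_on (cball p r) h"
      using assms unfolding locally_lipschitz_def by blast
    then have "continuous_on (ball p r) h"
      using lipschitz_on_continuous_on continuous_on_subset ball_subset_cball by blast
    then show ?thesis
      using \<open>r > 0\<close> by (simp add: continuous_on_eq_continuous_at)
  qed
  then show ?thesis
    by (simp add: continuous_at_imp_continuous_on)
qed

text \<open>The C1 predicate supplies some continuous derivative; uniqueness of derivatives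
  identifies it with \<open>deriv x\<close>.\<close>

lemma C1_differentiable_on_UNIV_real:
  fixes x :: "real \<Rightarrow> real"
  assumes "x C1_differentiable_on UNIV"
  shows "(x has_real_derivative deriv x t) (at t)" and "continuous_on UNIV (deriv x)"
proof -
  obtain D where D: "\<And>t. (x has_real_derivative D t) (at t)" "continuous_on UNIV D"
    using assms by (auto simp: C1_differentiable_on_def has_real_derivative_iff_has_vector_derivative)
  moreover have "deriv x = D"
    using D by (auto intro: DERIV_imp_deriv)
  ultimately show "(x has_real_derivative deriv x t) (at t)" "continuous_on UNIV (deriv x)"
    by auto
qed

section \<open>Assembly of the periodic solution of the system\<close>

theorem theorem2p3:
  fixes a T lam :: real and b :: nat
    and g f :: "real \<times> real \<times> real \<Rightarrow> real"
    and \<phi> :: "real \<times> real \<Rightarrow> real"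
    and x\<^sub>0 :: "real \<Rightarrow> real"
    and y :: "nat \<Rightarrow> real \<Rightarrow> real"
  assumes "a > 0" and "b \<ge> 1" and "T > 0"
    and "continuous_on UNIV g"
    and "locally_lipschitz \<phi>"
    and "continuous_on UNIV f"
    and "\<And>t u v. f (t + T, u, v) = f (t, u, v)"
    and "CARD('n::{finite,linorder}) = b + 2"
    and "lam \<ge> 0"
    and "periodic_solution_delay T a b g \<phi> f lam x\<^sub>0"
    and "\<And>t. y 0 t = deriv x\<^sub>0 t"
    and "\<And>i t. i \<in> {1..b} \<Longrightarrow>
           y i t = (LBINT s=-\<infinity>..ereal t. gamma_density a i (t - s) * \<phi> (x\<^sub>0 s, y 0 s))"
  shows "periodic_solution_system T
           (\<lambda>t w. G_map a b g \<phi> w + lam *\<^sub>R F_map f t w)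
           (\<lambda>t. tuple (\<lambda>j. if j = 0 then x\<^sub>0 t else y (j - 1) t)
              :: real ^ 'n::{finite,linorder})"
proof -
  let ?x' = "deriv x\<^sub>0" and ?x'' = "deriv (deriv x\<^sub>0)"
  have C1: "x\<^sub>0 C1_differentiable_on UNIV" "?x' C1_differentiable_on UNIV"
    and per: "\<And>t. x\<^sub>0 (t + T) = x\<^sub>0 t"
    and eq: "\<And>t. ?x'' t =
            g (x\<^sub>0 t, ?x' t, (LBINT s=-\<infinity>..ereal t. gamma_density a b (t - s) * \<phi> (x\<^sub>0 s, ?x' s)))
            + lam * f (t, x\<^sub>0 t, ?x' t)"
    using assms(10) by (auto simp: periodic_solution_delay_def)
  note dx = C1_differentiable_on_UNIV_real[OF C1(1)] and dx' = C1_differentiable_on_UNIV_real[OF C1(2)]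
  have y0: "y 0 = ?x'"
    using assms(11) by auto
  have contx: "continuous_on UNIV x\<^sub>0"
    using dx(1) by (intro continuous_at_imp_continuous_on ballI DERIV_isCont)
  \<comment> \<open>The derivative at \<open>t + T\<close> is also a derivative at \<open>t\<close>
    of the shifted function, which is \<open>x\<^sub>0\<close> itself.\<close>
  have per': "?x' (t + T) = ?x' t" for t
    using dx(1)[of "t + T"] DERIV_unique[OF _ dx(1)[of t]] by (simp add: DERIV_shift per)

  define p where "p s = \<phi> (x\<^sub>0 s, ?x' s)" for s
  \<comment> \<open>\<open>Y\<close> stands in for \<open>y\<close> only at indices 1 to
    \<open>b\<close>; \<open>y 0\<close> is the derivative of \<open>x\<^sub>0\<close>, so the chain
    is driven by \<open>p\<close> at index 1.\<close>
  define Y where "Y i t = (LBINT s=-\<infinity>..ereal t. gamma_density a i (t - s) * p s)" for i and t :: real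
  have perp: "p (t + T) = p t" for t
    by (simp add: p_def per per')
  have contp: "continuous_on UNIV p"
    unfolding p_def
    by (intro continuous_on_compose2[OF locally_lipschitz_imp_continuous_on[OF assms(5)]]
        continuous_intros contx dx(2)) auto
  have bddp: "bounded (range p)"
    by (rule bounded_periodic_continuous[OF \<open>T > 0\<close> contp perp])
  have dY: "(Y i has_real_derivative a * ((if i = 1 then p t else Y (i - 1) t) - Y i t)) (at t)"
    if "i \<ge> 1" for i t
    unfolding Y_def by (rule gamma_density_convolution_has_derivative[OF \<open>a > 0\<close> contp bddp that])
  have yY: "y i = Y i" if "i \<in> {1..b}" for i
    using assms(12)[OF that] by (auto simp: Y_def p_def y0)
  have contY: "continuous_on UNIV (Y i)" if "i \<ge> 1" for i
    using dY[OF that] by (intro continuous_at_imp_continuous_on ballI DERIV_isCont)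

  define \<xi> where "\<xi> t j = (if j = 0 then x\<^sub>0 t else y (j - 1) t)" for t j
  \<comment> \<open>This candidate derivative is written without \<open>G_map\<close> and
    \<open>F_map\<close>, so that its continuity is read off directly; the equation identifies it
    with the vector field afterwards.\<close>
  define \<xi>' where "\<xi>' t j = (if j = 0 then ?x' t else if j = 1 then ?x'' t
      else a * ((if j = 2 then p t else Y (j - 2) t) - Y (j - 1) t))" for t j
  have less: "j - 1 \<in> {1..b}" if "j < CARD('n)" "j \<ge> 2" for j
    using that assms(8) by auto
  have d\<xi>: "((\<lambda>t. \<xi> t j) has_real_derivative \<xi>' t j) (at t)" if "j < CARD('n)" for t j
  proof -
    consider "j = 0" | "j = 1" | "j \<ge> 2" by linarith
    then show ?thesis
    proof cases
      case 3
      then have "j - Suc (Suc 0) = j - 1 - 1" "j = 2 \<longleftrightarrow> j - 1 = 1" by auto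
      then show ?thesis
        using dY[of "j - 1" t] yY[OF less[OF that 3]] 3
        by (auto simp: \<xi>_def \<xi>'_def numeral_2_eq_2)
    qed (auto simp: \<xi>_def \<xi>'_def y0 dx dx')
  qed
  have "continuous_on UNIV (\<lambda>t. \<xi>' t j)" if "j < CARD('n)" for j
  proof -
    consider "j = 0" | "j = 1" | "j = 2" | "j \<ge> 3" by linarith
    then show ?thesis
      by cases (auto simp: \<xi>'_def intro!: continuous_intros dx dx' contp contY)
  qed
  then have C1\<xi>: "(\<lambda>t. tuple (\<xi> t) :: real ^ 'n::{finite,linorder}) C1_differentiable_on UNIV"
    unfolding C1_differentiable_on_def
    by (intro exI[of _ "\<lambda>t. tuple (\<xi>' t)"] conjI ballI has_vector_derivative_tuple d\<xi> continuous_on_tuple)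
  have per\<xi>: "tuple (\<xi> (t + T)) = (tuple (\<xi> t) :: real ^ 'n::{finite,linorder})" for t
  proof -
    have "Y i (t + T) = Y i t" for i
      unfolding Y_def by (rule interval_integral_convolution_shift[where p = p and T = T, OF perp])
    then have "\<xi> (t + T) j = \<xi> t j" if "j < CARD('n)" for j
      using per per' y0 yY[OF less[OF that]]
      by (cases "j \<ge> 2") (auto simp: \<xi>_def not_le less_2_cases_iff)
    moreover have "pos k < CARD('n)" for k :: 'n
      using bij_betw_pos[where 'n = 'n] by (auto simp: bij_betw_def)
    ultimately show ?thesis
      by (simp add: tuple_def)
  qed
  have "G_map a b g \<phi> (tuple (\<xi> t)) + lam *\<^sub>R F_map f t (tuple (\<xi> t)) = (tuple (\<xi>' t) :: real ^ 'n::{finite,linorder})" for t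
  proof -
    let ?w = "tuple (\<xi> t) :: real ^ 'n::{finite,linorder}"
    have c: "coord ?w j = \<xi> t j" if "j < b + 2" for j
      using that assms(8) by (intro coord_tuple) simp
    \<comment> \<open>Here the delay disappears: the integral in the equation is the last chain
      variable \<open>y b\<close>.\<close>
    have x'': "?x'' t = g (x\<^sub>0 t, ?x' t, y b t) + lam * f (t, x\<^sub>0 t, ?x' t)"
      using eq[of t] yY[of b] \<open>b \<ge> 1\<close> by (simp add: Y_def p_def)
    show ?thesis
    proof (rule vec_eq_iff[THEN iffD2], intro allI)
      fix k :: 'n
      have k: "pos k < b + 2"
        using bij_betw_pos[where 'n = 'n] assms(8) by (auto simp: bij_betw_def)
      consider "pos k = 0" | "pos k = 1" | "pos k = 2" | "pos k \<ge> 3" by linarith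
      then show "(G_map a b g \<phi> ?w + lam *\<^sub>R F_map f t ?w) $ k = (tuple (\<xi>' t) :: real ^ 'n::{finite,linorder}) $ k"
      proof cases
        case 4
        \<comment> \<open>These bounds keep the coordinates read by \<open>G_map\<close> in the
          range where \<open>c\<close> evaluates them and \<open>y\<close> agrees with
          \<open>Y\<close>.\<close>
        then have "pos k - 2 \<in> {1..b}" "pos k - 1 \<in> {1..b}" "pos k - 2 + 1 < b + 2" "pos k - 1 + 1 < b + 2"
          using k by auto
        then show ?thesis
          using 4 by (simp add: G_map_def F_map_def tuple_nth Let_def c \<xi>'_def)
            (simp add: \<xi>_def yY)
      qed (use \<open>b \<ge> 1\<close> in \<open>auto simp: G_map_def F_map_def tuple_nth Let_def c \<xi>'_def x'' \<xi>_def y0 yY p_def\<close>)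
    qed
  qed
  then have "((\<lambda>t. tuple (\<xi> t) :: real ^ 'n::{finite,linorder}) has_vector_derivative
      G_map a b g \<phi> (tuple (\<xi> t)) + lam *\<^sub>R F_map f t (tuple (\<xi> t))) (at t)" for t
    using has_vector_derivative_tuple[OF d\<xi>] by simp
  then show ?thesis
    using C1\<xi> per\<xi> by (simp add: periodic_solution_system_def \<xi>_def[abs_def])
qed

end
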